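(* Let $\Gamma$ be a finite index subgroup of the discrete Heisenberg group $H$, let $m_\Gamma=[\operatorname{Im} f:\Gamma\cap \operatorname{Im} f]$, and let $A\in M(2,\mathbb Z)$ be such that $A\mathbb Z^2=g(\Gamma)$. Then $A$ is nonsingular and there exists a map $i_\Gamma:A\mathbb Z^2\to\mathbb Z$ defined by $$i_\Gamma(x,y)=\min\{z\ge 0:(x,y,z)\in\Gamma\}$$ such that $$\Gamma=\{(x,y,i_\Gamma(x,y)+km_\Gamma):(x,y)\in A\mathbb Z^2,\ k\in\mathbb Z\}.$$
   Context: $H$ is the discrete Heisenberg group: the set $\mathbb Z^3$ with multiplication $(x,y,z)(x',y',z')=(x+x',y+y',z+z'+xy')$. The homomorphisms $f:\mathbb Z\to H$, $f(z)=(0,0,z)$, and $g:H\to\mathbb Z^2$, $g(x,y,z)=(x,y)$, form a short exact sequence $0\to\mathbb Z\to H\to\mathbb Z^2\to 0$. $M(2,\mathbb Z)$ denotes the $2\times2$ integer matrices, and $A\mathbb Z^2=\{Av:v\in\mathbb Z^2\}$. *)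

theory Defs
  imports "HOL-Analysis.Analysis" "HOL-Algebra.Elementary_Groups"
begin

definition heisenberg :: "(int \<times> int \<times> int) monoid"
  where "heisenberg =
    \<lparr>carrier = UNIV,
     monoid.mult = (\<lambda>(x, y, z) (x', y', z'). (x + x', y + y', z + z' + x * y')),
     one = (0, 0, 0)\<rparr>"

lemma heisenberg_simps [simp]:
  "carrier heisenberg = UNIV"
  "\<one>\<^bsub>heisenberg\<^esub> = (0, 0, 0)"
  "(x, y, z) \<otimes>\<^bsub>heisenberg\<^esub> (x', y', z') = (x + x', y + y', z + z' + x * y')"
  by (simp_all add: heisenberg_def)

lemma group_heisenberg: "group heisenberg"
proof (rule groupI)
  fix p assume "p \<in> carrier heisenberg"
  obtain x y z where p: "p = (x, y, z)" by (cases p)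
  have "(- x, - y, x * y - z) \<otimes>\<^bsub>heisenberg\<^esub> p = \<one>\<^bsub>heisenberg\<^esub>"
    by (simp add: p)
  then show "\<exists>q\<in>carrier heisenberg. q \<otimes>\<^bsub>heisenberg\<^esub> p = \<one>\<^bsub>heisenberg\<^esub>"
    by (intro bexI) auto
qed (auto simp: algebra_simps)

definition int_plane_group :: "(int ^ 2) monoid"
  where "int_plane_group = \<lparr>carrier = UNIV, monoid.mult = (+), one = 0\<rparr>"

lemma int_plane_group_simps [simp]:
  "carrier int_plane_group = UNIV"
  "\<one>\<^bsub>int_plane_group\<^esub> = 0"
  "v \<otimes>\<^bsub>int_plane_group\<^esub> w = v + w"
  by (simp_all add: int_plane_group_def)

lemma group_int_plane_group: "group int_plane_group"
  by (rule groupI) (auto simp: algebra_simps intro: exI [of _ "- x" for x])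

definition heis_f :: "int \<Rightarrow> int \<times> int \<times> int"
  where "heis_f z = (0, 0, z)"

definition heis_g :: "int \<times> int \<times> int \<Rightarrow> int ^ 2"
  where "heis_g = (\<lambda>(x, y, z). vector [x, y])"

text \<open>The sequence of \<open>heis_f\<close> and \<open>heis_g\<close> is short exact. The library's
  \<open>short_exact_sequence\<close> does not apply, since it needs all groups to have the same
  element type.\<close>

lemma heis_f_mon: "heis_f \<in> mon integer_group heisenberg"
  by (auto simp: mon_def hom_def heis_f_def inj_on_def)

lemma heis_g_epi: "heis_g \<in> epi heisenberg int_plane_group"
proof -
  have "v \<in> range heis_g" for v
  proof
    show "v = heis_g (v $ 1, v $ 2, 0)"
      by (simp add: heis_g_def vec_eq_iff forall_2)
  qed simp
  then show ?thesis
    by (auto simp: epi_def hom_def heis_g_def vec_eq_iff forall_2)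
qed

lemma heis_exact: "kernel heisenberg int_plane_group heis_g = range heis_f"
  by (auto simp: kernel_def heis_g_def heis_f_def vec_eq_iff forall_2)

definition finite_index :: "('a, 'b) monoid_scheme \<Rightarrow> 'a set \<Rightarrow> bool"
  where "finite_index G K \<longleftrightarrow> subgroup K G \<and> finite (rcosets\<^bsub>G\<^esub> K)"

text \<open>The index of \<open>K\<close> in a subgroup \<open>L\<close> of \<open>G\<close>; it is \<open>0\<close> if
  there are infinitely many cosets.\<close>

definition subgroup_index :: "('a, 'b) monoid_scheme \<Rightarrow> 'a set \<Rightarrow> 'a set \<Rightarrow> nat"
  where "subgroup_index G L K = card (rcosets\<^bsub>G\<lparr>carrier := L\<rparr>\<^esub> K)"

definition m_index :: "(int \<times> int \<times> int) set \<Rightarrow> nat"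
  where "m_index \<Gamma> = subgroup_index heisenberg (range heis_f) (\<Gamma> \<inter> range heis_f)"

end

theory Submission
  imports Defs
begin

text \<open>
  The centre of the Heisenberg group is the vertical axis \<open>{(0, 0, z)}\<close>, and multiplying by
  a central element only translates the last coordinate. Two points of \<open>\<Gamma>\<close> over the same
  \<open>(x, y)\<close> therefore differ by a vertical element of \<open>\<Gamma>\<close>, and every nonempty fibre of
  \<open>\<Gamma>\<close> over the plane is a coset of the subgroup
  \<open>S = {z. (0, 0, z) \<in> \<Gamma>}\<close> of \<open>\<int>\<close> (lemma \<open>heisenberg_fibre\<close>).

  Finite index is used through a single consequence: every group element has a positive power
  in \<open>\<Gamma>\<close> (\<open>finite_index_pow_mem\<close>). Applied to \<open>(0, 0, 1)\<close> it gives
  \<open>S \<noteq> {0}\<close>, so \<open>S = d\<int>\<close> with \<open>d > 0\<close>, and counting the cosets of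
  \<open>d\<int>\<close> identifies \<open>d\<close> as \<open>m_index \<Gamma>\<close>. A fibre is thus a full residue class
  modulo \<open>m_index \<Gamma>\<close>, which has a least nonnegative member, namely the remainder of any of
  its members. Applied to \<open>(1, 0, 0)\<close> and \<open>(0, 1, 0)\<close>, it puts nonzero multiples of
  both unit vectors into the image of \<open>A\<close>, so that the image of \<open>A\<close> has rank two and
  \<open>det A \<noteq> 0\<close>.
\<close>

text \<open>Pigeonhole: infinitely many powers of \<open>x\<close> lie in finitely many cosets, and two powers
  in the same coset have their quotient in \<open>K\<close>.\<close>

lemma finite_index_pow_mem:
  fixes G (structure)
  assumes "group G" and "finite_index G K" and x: "x \<in> carrier G"
  obtains n :: nat where "n > 0" and "x [^] n \<in> K"
proof -
  interpret group G by fact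
  have K: "subgroup K G" and fin: "finite (rcosets K)"
    using assms(2) by (auto simp: finite_index_def)
  have "range (\<lambda>n::nat. K #> x [^] n) \<subseteq> rcosets K"
    using x K by (auto intro!: rcosetsI subgroup.subset)
  then have "\<not> inj (\<lambda>n::nat. K #> x [^] n)"
    using fin finite_subset range_inj_infinite by blast
  then obtain i j :: nat where "i < j" and eq: "K #> x [^] i = K #> x [^] j"
    by (metis injI linorder_neqE_nat)
  have "x [^] j \<in> K #> x [^] i"
    using repr_independenceD [OF K _ eq] x by simp
  then obtain h where h: "h \<in> K" "x [^] j = h \<otimes> x [^] i"
    by (auto simp: r_coset_def)
  have "x [^] (j - i) \<otimes> x [^] i = h \<otimes> x [^] i"
    using x h(2) \<open>i < j\<close> by (simp add: nat_pow_mult)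
  moreover have "h \<in> carrier G"
    using K h(1) by (rule subgroup.mem_carrier)
  ultimately have "x [^] (j - i) = h"
    using x by simp
  with h(1) \<open>i < j\<close> show thesis
    by (intro that [of "j - i"]) auto
qed

lemma heisenberg_pow_axes:
  "(1, 0, 0) [^]\<^bsub>heisenberg\<^esub> (n::nat) = (int n, 0, 0)"
  "(0, 1, 0) [^]\<^bsub>heisenberg\<^esub> (n::nat) = (0, int n, 0)"
  "(0, 0, 1) [^]\<^bsub>heisenberg\<^esub> (n::nat) = (0, 0, int n)"
  by (induction n) auto

lemma heisenberg_inv:
  "inv\<^bsub>heisenberg\<^esub> (x, y, z) = (- x, - y, x * y - z)"
  by (rule group.inv_equality [OF group_heisenberg]) auto

lemma heisenberg_fibre:
  assumes "subgroup \<Gamma> heisenberg" and z: "(x, y, z) \<in> \<Gamma>"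
  shows "(x, y, z') \<in> \<Gamma> \<longleftrightarrow> (0, 0, z' - z) \<in> \<Gamma>"
proof
  interpret subgroup \<Gamma> heisenberg by fact
  assume "(x, y, z') \<in> \<Gamma>"
  then have "inv\<^bsub>heisenberg\<^esub> (x, y, z) \<otimes>\<^bsub>heisenberg\<^esub> (x, y, z') \<in> \<Gamma>"
    using z group_heisenberg by (intro m_closed) (simp_all add: subgroup.m_inv_closed [OF assms(1)])
  then show "(0, 0, z' - z) \<in> \<Gamma>"
    by (simp add: heisenberg_inv)
next
  interpret subgroup \<Gamma> heisenberg by fact
  assume "(0, 0, z' - z) \<in> \<Gamma>"
  from m_closed [OF z this] show "(x, y, z') \<in> \<Gamma>"
    by simp
qed

text \<open>Division with remainder by the least positive element.\<close>

lemma int_subgroup_eq_multiples: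
  fixes S :: "int set"
  assumes S: "subgroup S integer_group" and "n > 0" and "int n \<in> S"
  obtains d :: nat where "d > 0" and "S = {z. int d dvd z}"
proof -
  interpret integer: group integer_group by simp
  define d where "d = (LEAST d. d > 0 \<and> int d \<in> S)"
  have d: "d > 0" "int d \<in> S"
    using LeastI [of "\<lambda>d. d > 0 \<and> int d \<in> S"] assms(2,3) unfolding d_def by auto
  have mult: "k * int d \<in> S" for k
    using integer.subgroup_int_pow_closed [OF S d(2), of k] by simp
  have "int d dvd z" if "z \<in> S" for z
  proof -
    have "z + (- (z div int d)) * int d \<in> S"
      using subgroup.m_closed [OF S that mult [of "- (z div int d)"]] by simp
    then have "z mod int d \<in> S"
      by (simp add: minus_div_mult_eq_mod)
    moreover have "0 \<le> z mod int d" "z mod int d < int d"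
      using d(1) by auto
    ultimately have "\<not> nat (z mod int d) > 0"
      using not_less_Least [of "nat (z mod int d)" "\<lambda>d. d > 0 \<and> int d \<in> S"]
      unfolding d_def [symmetric] by (auto simp: nat_less_iff)
    then show ?thesis
      using \<open>0 \<le> z mod int d\<close> by (simp add: dvd_eq_mod_eq_0)
  qed
  moreover have "z \<in> S" if "int d dvd z" for z
    using that mult by (auto simp: dvd_def mult.commute)
  ultimately show thesis
    using d(1) by (intro that [of d]) auto
qed

lemma heisenberg_vertical_subgroup:
  assumes "subgroup \<Gamma> heisenberg"
  shows "subgroup {z. (0, 0, z) \<in> \<Gamma>} integer_group"
proof -
  interpret subgroup \<Gamma> heisenberg by fact
  show ?thesis
  proof (rule group.subgroupI)
    show "{z. (0, 0, z) \<in> \<Gamma>} \<noteq> {}"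
      using one_closed by auto
  next
    fix z assume "z \<in> {z. (0, 0, z) \<in> \<Gamma>}"
    then show "inv\<^bsub>integer_group\<^esub> z \<in> {z. (0, 0, z) \<in> \<Gamma>}"
      using subgroup.m_inv_closed [OF assms, of "(0, 0, z)"] group_heisenberg
      by (simp add: heisenberg_inv)
  next
    fix z w assume "z \<in> {z. (0, 0, z) \<in> \<Gamma>}" "w \<in> {z. (0, 0, z) \<in> \<Gamma>}"
    then show "z \<otimes>\<^bsub>integer_group\<^esub> w \<in> {z. (0, 0, z) \<in> \<Gamma>}"
      using m_closed [of "(0, 0, z)" "(0, 0, w)"] by simp
  qed auto
qed

text \<open>Under \<open>heis_f\<close> the cosets become the residue classes modulo \<open>d\<close>, which the
  remainders \<open>0, \<dots>, d - 1\<close> represent without repetition.\<close>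

lemma m_index_eq:
  assumes S: "{z. (0, 0, z) \<in> \<Gamma>} = {z. int d dvd z}" and "d > 0"
  shows "m_index \<Gamma> = d"
proof -
  define C where "C = (\<lambda>a. heis_f ` {z. int d dvd z - a})"
  have \<Gamma>: "\<Gamma> \<inter> range heis_f = heis_f ` {z. int d dvd z}"
    using S by (auto simp: heis_f_def)
  have C: "(\<Gamma> \<inter> range heis_f) #>\<^bsub>heisenberg\<^esub> heis_f a = C a" for a
  proof -
    have "heis_f z \<in> (\<lambda>h. h \<otimes>\<^bsub>heisenberg\<^esub> heis_f a) ` heis_f ` {z. int d dvd z}"
      if "int d dvd z - a" for z
      using that by (intro image_eqI [of _ _ "heis_f (z - a)"]) (auto simp: heis_f_def)
    then show ?thesis
      unfolding \<Gamma> C_def r_coset_def by (auto simp: heis_f_def)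
  qed
  have "rcosets\<^bsub>heisenberg\<lparr>carrier := range heis_f\<rparr>\<^esub> (\<Gamma> \<inter> range heis_f) = range C"
    by (auto simp: RCOSETS_def C)
  also have "range C = C ` {0..<int d}"
  proof -
    have "C a = C (a mod int d)" for a
      by (simp add: C_def mod_eq_dvd_iff [symmetric])
    then show ?thesis
      using \<open>d > 0\<close> by (auto intro!: image_eqI [where x = "a mod int d" for a])
  qed
  finally have "m_index \<Gamma> = card (C ` {0..<int d})"
    by (simp add: m_index_def subgroup_index_def)
  also have "\<dots> = card {0..<int d}"
  proof (rule card_image, rule inj_onI)
    fix a b assume ab: "a \<in> {0..<int d}" "b \<in> {0..<int d}" and "C a = C b"
    moreover have "heis_f a \<in> C a"
      by (simp add: C_def)
    ultimately have "int d dvd a - b"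
      by (auto simp: C_def heis_f_def)
    then show "a = b"
      using ab by (simp add: mod_eq_dvd_iff [symmetric])
  qed
  finally show ?thesis
    by simp
qed

text \<open>If \<open>A\<close> maps the columns of \<open>B\<close> to nonzero multiples of the two unit vectors, then
  \<open>det A * det B\<close> is the product of the two factors.\<close>

lemma det_nonzero_if_range_meets_axes:
  fixes A :: "int ^ 2 ^ 2"
  assumes "vector [n, 0] \<in> range (\<lambda>v. A *v v)" and "vector [0, m] \<in> range (\<lambda>v. A *v v)"
    and "n \<noteq> 0" and "m \<noteq> 0"
  shows "det A \<noteq> 0"
proof
  assume "det A = 0"
  obtain v w where "A *v v = vector [n, 0]" "A *v w = vector [0, m]"
    using assms(1,2) by (metis imageE)
  then have eqs: "A$1$1 * v$1 + A$1$2 * v$2 = n" "A$2$1 * v$1 + A$2$2 * v$2 = 0"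
    "A$1$1 * w$1 + A$1$2 * w$2 = 0" "A$2$1 * w$1 + A$2$2 * w$2 = m"
    by (simp_all add: vec_eq_iff forall_2 matrix_vector_mult_def sum_2)
  have "n * m = (A$1$1 * v$1 + A$1$2 * v$2) * (A$2$1 * w$1 + A$2$2 * w$2)
      - (A$2$1 * v$1 + A$2$2 * v$2) * (A$1$1 * w$1 + A$1$2 * w$2)"
    unfolding eqs by simp
  also have "\<dots> = det A * (v$1 * w$2 - v$2 * w$1)"
    by (simp add: det_2 algebra_simps)
  finally show False
    using \<open>det A = 0\<close> assms(3,4) by simp
qed

theorem proposition3p1:
  fixes \<Gamma> :: "(int \<times> int \<times> int) set" and A :: "int ^ 2 ^ 2"
  assumes "finite_index heisenberg \<Gamma>"
    and "range (\<lambda>v. A *v v) = heis_g ` \<Gamma>"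
  shows "det A \<noteq> 0 \<and>
    (\<exists>i :: int ^ 2 \<Rightarrow> int.
      (\<forall>x y. vector [x, y] \<in> range (\<lambda>v. A *v v) \<longrightarrow>
        i (vector [x, y]) \<in> {z. 0 \<le> z \<and> (x, y, z) \<in> \<Gamma>} \<and>
        (\<forall>z \<in> {z. 0 \<le> z \<and> (x, y, z) \<in> \<Gamma>}. i (vector [x, y]) \<le> z)) \<and>
      \<Gamma> = {(x, y, i (vector [x, y]) + k * int (m_index \<Gamma>)) | x y k.
            vector [x, y] \<in> range (\<lambda>v. A *v v)})"
proof
  have sub: "subgroup \<Gamma> heisenberg"
    using assms(1) by (simp add: finite_index_def)
  have pow: "\<exists>n::nat. n > 0 \<and> p [^]\<^bsub>heisenberg\<^esub> n \<in> \<Gamma>" for p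
    using finite_index_pow_mem [OF group_heisenberg assms(1), of p] by auto
  have range_iff: "vector [x, y] \<in> range (\<lambda>v. A *v v) \<longleftrightarrow> (\<exists>z. (x, y, z) \<in> \<Gamma>)" for x y
    unfolding assms(2) by (force simp: heis_g_def image_iff vec_eq_iff forall_2)

  obtain n m :: nat where "n > 0" "(int n, 0, 0) \<in> \<Gamma>" "m > 0" "(0, int m, 0) \<in> \<Gamma>"
    using pow [of "(1, 0, 0)"] pow [of "(0, 1, 0)"] by (auto simp: heisenberg_pow_axes)
  then show "det A \<noteq> 0"
    by (intro det_nonzero_if_range_meets_axes [of "int n" A "int m"]) (auto simp: range_iff)

  obtain c :: nat where "c > 0" "(0, 0, int c) \<in> \<Gamma>"
    using pow [of "(0, 0, 1)"] by (auto simp: heisenberg_pow_axes)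
  then obtain d :: nat where "d > 0" and S: "{z. (0, 0, z) \<in> \<Gamma>} = {z. int d dvd z}"
    using int_subgroup_eq_multiples [OF heisenberg_vertical_subgroup [OF sub]] by blast
  have d: "int (m_index \<Gamma>) = int d"
    using m_index_eq [OF S \<open>d > 0\<close>] by simp
  have fibre: "(x, y, z') \<in> \<Gamma> \<longleftrightarrow> z' mod int d = z mod int d" if "(x, y, z) \<in> \<Gamma>" for x y z z'
    using heisenberg_fibre [OF sub that] S by (auto simp: mod_eq_dvd_iff)

  \<comment> \<open>The remainder is the same for all points of a fibre, so the choice is immaterial;
    off the image of \<open>A\<close> the value is arbitrary.\<close>
  define i :: "int ^ 2 \<Rightarrow> int"
    where "i = (\<lambda>v. (SOME z. (v$1, v$2, z) \<in> \<Gamma>) mod int d)"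
  have i_eq: "i (vector [x, y]) = z mod int d" if "(x, y, z) \<in> \<Gamma>" for x y z
    using fibre [OF that] someI [of "\<lambda>z. (x, y, z) \<in> \<Gamma>", OF that] by (simp add: i_def)
  have i_mem: "(x, y, i (vector [x, y]) + k * int d) \<in> \<Gamma>" if "(x, y, z) \<in> \<Gamma>" for x y z k
    using fibre [OF that] i_eq [OF that] by simp
  have i_least: "0 \<le> i (vector [x, y])" "0 \<le> z \<Longrightarrow> i (vector [x, y]) \<le> z"
    if "(x, y, z) \<in> \<Gamma>" for x y z
    using i_eq [OF that] \<open>d > 0\<close> by (simp_all add: zmod_le_nonneg_dividend)

  show "\<exists>i :: int ^ 2 \<Rightarrow> int.
      (\<forall>x y. vector [x, y] \<in> range (\<lambda>v. A *v v) \<longrightarrow>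
        i (vector [x, y]) \<in> {z. 0 \<le> z \<and> (x, y, z) \<in> \<Gamma>} \<and>
        (\<forall>z \<in> {z. 0 \<le> z \<and> (x, y, z) \<in> \<Gamma>}. i (vector [x, y]) \<le> z)) \<and>
      \<Gamma> = {(x, y, i (vector [x, y]) + k * int (m_index \<Gamma>)) | x y k.
            vector [x, y] \<in> range (\<lambda>v. A *v v)}"
    unfolding range_iff d
  proof (intro exI [of _ i] conjI allI impI)
    fix x y assume "\<exists>z. (x, y, z) \<in> \<Gamma>"
    then show "i (vector [x, y]) \<in> {z. 0 \<le> z \<and> (x, y, z) \<in> \<Gamma>}"
      using i_mem [of x y _ 0] i_least(1) by auto
    show "\<forall>z\<in>{z. 0 \<le> z \<and> (x, y, z) \<in> \<Gamma>}. i (vector [x, y]) \<le> z"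
      using i_least(2) by auto
  next
    have "\<exists>k. z = i (vector [x, y]) + k * int d" if "(x, y, z) \<in> \<Gamma>" for x y z
      using i_eq [OF that] by (intro exI [of _ "z div int d"]) simp
    then show "\<Gamma> = {(x, y, i (vector [x, y]) + k * int d) | x y k. \<exists>z. (x, y, z) \<in> \<Gamma>}"
      using i_mem by fastforce
  qed
qed

end
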